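(* Let $f:\mathbb{R}^d\to\mathbb{R}^d$ belong to an RKHS of functions $\mathbb{R}^d\to\mathbb{R}^d$ with matrix-valued reproducing kernel $K$, and suppose that for some constant $N_K$, $$d_{K_{ii}}^2(u,v):=K_{ii}(u,u)-2K_{ii}(u,v)+K_{ii}(v,v)\le N_K^2|u-v|^2,\qquad \forall u,v\in\mathbb{R}^d,\ i=1,\dots,d.$$ Then, for $x_0\in\mathbb{R}^d$, the initial value problem $$\dot x(t)=f(x(t)),\qquad x(0)=x_0,$$ has a unique solution defined on $[0,+\infty)$.
   Context: A vector-valued RKHS $H$ of functions $\mathbb{R}^d\to\mathbb{R}^d$ with reproducing kernel $K:\mathbb{R}^d\times\mathbb{R}^d\to\mathbb{R}^{d\times d}$ is a real Hilbert space of such functions for which $K(\cdot,x)v\in H$ and $v^Tf(x)=\langle f,K(\cdot,x)v\rangle_H$ for all $f\in H$, $x,v\in\mathbb{R}^d$. $K_{ii}$ denotes the $i$-th diagonal entry of $K$ and $|\cdot|$ the Euclidean norm. *)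

theory Defs
  imports "HOL-Analysis.Analysis"
begin

text \<open>
  A Hilbert space of functions is given by a carrier \<open>H\<close> and an inner product \<open>ip\<close> that is only
  constrained on \<open>H\<close>; the vector space operations are pointwise.
\<close>

definition ip_norm :: "(('a \<Rightarrow> 'b) \<Rightarrow> ('a \<Rightarrow> 'b) \<Rightarrow> real) \<Rightarrow> ('a \<Rightarrow> 'b) \<Rightarrow> real" where
  "ip_norm ip f = sqrt (ip f f)"

locale hilbert_function_space =
  fixes H :: "('a \<Rightarrow> 'b::real_vector) set"
    and ip :: "('a \<Rightarrow> 'b) \<Rightarrow> ('a \<Rightarrow> 'b) \<Rightarrow> real"
  assumes zero_mem: "(\<lambda>x. 0) \<in> H"
    and add_mem: "f \<in> H \<Longrightarrow> g \<in> H \<Longrightarrow> (\<lambda>x. f x + g x) \<in> H"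
    and scale_mem: "f \<in> H \<Longrightarrow> (\<lambda>x. c *\<^sub>R f x) \<in> H"
    and ip_commute: "f \<in> H \<Longrightarrow> g \<in> H \<Longrightarrow> ip f g = ip g f"
    and ip_add: "f \<in> H \<Longrightarrow> g \<in> H \<Longrightarrow> h \<in> H \<Longrightarrow> ip (\<lambda>x. f x + g x) h = ip f h + ip g h"
    and ip_scale: "f \<in> H \<Longrightarrow> g \<in> H \<Longrightarrow> ip (\<lambda>x. c *\<^sub>R f x) g = c * ip f g"
    and ip_nonneg: "f \<in> H \<Longrightarrow> 0 \<le> ip f f"
    and ip_definite: "f \<in> H \<Longrightarrow> ip f f = 0 \<Longrightarrow> f = (\<lambda>x. 0)"
    and complete:
      "\<lbrakk>\<And>n. F n \<in> H;
        \<And>e. 0 < e \<Longrightarrow> \<exists>N::nat. \<forall>m\<ge>N. \<forall>n\<ge>N. ip_norm ip (\<lambda>x. F m x - F n x) < e\<rbrakk>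
       \<Longrightarrow> \<exists>f\<in>H. (\<lambda>n. ip_norm ip (\<lambda>x. F n x - f x)) \<longlonglongrightarrow> 0"

locale vector_rkhs = hilbert_function_space H ip
  for H :: "(real ^ 'd::finite \<Rightarrow> real ^ 'd) set" and ip +
  fixes K :: "real ^ 'd \<Rightarrow> real ^ 'd \<Rightarrow> real ^ 'd ^ 'd"
  assumes kernel_mem: "(\<lambda>y. K y x *v v) \<in> H"
    and reproducing: "f \<in> H \<Longrightarrow> v \<bullet> f x = ip f (\<lambda>y. K y x *v v)"

definition kernel_dist_sq :: "('a \<Rightarrow> 'a \<Rightarrow> real) \<Rightarrow> 'a \<Rightarrow> 'a \<Rightarrow> real" where
  "kernel_dist_sq k u v = k u u - 2 * k u v + k v v"

text \<open>
  The derivative is taken within \<open>[0, \<infinity>)\<close>, hence it is one-sided at \<open>0\<close> and the values of \<open>x\<close>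
  at negative times are irrelevant.
\<close>

definition solves_ivp ::
  "('a::real_normed_vector \<Rightarrow> 'a) \<Rightarrow> 'a \<Rightarrow> (real \<Rightarrow> 'a) \<Rightarrow> bool" where
  "solves_ivp f x0 x \<longleftrightarrow>
     x 0 = x0 \<and> (\<forall>t\<ge>0. (x has_vector_derivative f (x t)) (at t within {0..}))"

end

theory Submission
  imports Defs
begin

text \<open>
  By the reproducing property and Cauchy--Schwarz in \<open>H\<close>,
  \<open>\<bar>f\<^sub>i(u) - f\<^sub>i(v)\<bar> \<le> \<parallel>f\<parallel> d\<^bsub>K\<^sub>i\<^sub>i\<^esub>(u,v) \<le> \<parallel>f\<parallel> \<bar>N\<^sub>K\<bar> \<bar>u - v\<bar>\<close>, so \<open>f\<close> is globally Lipschitz, with constant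
  \<open>L\<close> say. A solution on the whole half-line is then obtained in one step: after the substitution
  \<open>x(t) = e\<^sup>c\<^sup>t y(t)\<close> with \<open>c = L + 1\<close>, the Picard operator is a contraction with factor \<open>L/c\<close> on the
  bounded continuous functions. Two solutions agree because \<open>e\<^sup>-\<^sup>2\<^sup>L\<^sup>t \<bar>x(t) - y(t)\<bar>\<^sup>2\<close> is nonincreasing.
\<close>

subsection \<open>Lipschitz continuity of functions in the RKHS\<close>

context hilbert_function_space
begin

lemma diff_mem:
  assumes "f \<in> H" "g \<in> H"
  shows "(\<lambda>x. f x - g x) \<in> H"
  using add_mem[OF assms(1) scale_mem[OF assms(2), of "-1"]] by simp

lemma ip_diff_left:
  assumes "f \<in> H" "g \<in> H" "h \<in> H"
  shows "ip (\<lambda>x. f x - g x) h = ip f h - ip g h"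
  using ip_add[OF assms(1) scale_mem[OF assms(2), of "-1"] assms(3)]
    ip_scale[OF assms(2,3), of "-1"] by simp

lemma ip_diff_right:
  assumes "f \<in> H" "g \<in> H" "h \<in> H"
  shows "ip h (\<lambda>x. f x - g x) = ip h f - ip h g"
  by (simp add: ip_commute[OF assms(3)] ip_diff_left diff_mem assms)

text \<open>Nonnegativity of the squared norm of \<open>f - r g\<close>, with \<open>r\<close> the
  coefficient of the orthogonal projection of \<open>f\<close> onto \<open>g\<close>. Membership in
  \<open>H\<close> is tracked throughout because \<open>ip\<close> is constrained only
  there.\<close>

lemma Cauchy_Schwarz_ip:
  assumes f: "f \<in> H" and g: "g \<in> H"
  shows "(ip f g)\<^sup>2 \<le> ip f f * ip g g"
proof (cases "ip g g = 0")
  case True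
  then have "g = (\<lambda>x. 0)"
    using ip_definite g by blast
  then have "ip g f = 0"
    using ip_scale[OF g f, of 0] by simp
  then show ?thesis
    using True ip_commute[OF f g] by simp
next
  case False
  then have pos: "ip g g > 0"
    using ip_nonneg[OF g] by simp
  define r where "r = ip f g / ip g g"
  have m: "(\<lambda>x. r *\<^sub>R g x) \<in> H"
    using scale_mem g by blast
  have fg: "ip f (\<lambda>x. r *\<^sub>R g x) = r * ip f g"
    using ip_commute[OF f m] ip_commute[OF f g] ip_scale[OF g f] by simp
  have gg: "ip (\<lambda>x. r *\<^sub>R g x) (\<lambda>x. r *\<^sub>R g x) = r * (r * ip g g)"
    using ip_scale[OF g m] ip_commute[OF g m] ip_scale[OF g g] by simp
  have "0 \<le> ip (\<lambda>x. f x - r *\<^sub>R g x) (\<lambda>x. f x - r *\<^sub>R g x)"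
    using ip_nonneg[OF diff_mem[OF f m]] .
  also have "\<dots> = ip f f - 2 * (r * ip f g) + r * (r * ip g g)"
    using ip_commute[OF f m] fg gg
    by (simp add: ip_diff_left ip_diff_right f m diff_mem)
  also have "\<dots> = ip f f - (ip f g)\<^sup>2 / ip g g"
    using pos by (simp add: r_def power2_eq_square)
  finally show ?thesis
    using pos by (simp add: field_simps)
qed

end

context vector_rkhs
begin

text \<open>The reproducing property applied to a kernel section \<open>K(.,v) e_i\<close>
  itself.\<close>

lemma ip_kernel_axis:
  "ip (\<lambda>y. K y v *v axis i 1) (\<lambda>y. K y u *v axis i 1) = K u v $ i $ i"
  using reproducing[OF kernel_mem, of "axis i 1" u v "axis i 1"]
  by (simp add: inner_axis' matrix_vector_mult_basis column_def)

text \<open>Lets the two cross terms in the squared distance of kernel sections merge into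
  \<open>2 * k u v\<close>.\<close>

lemma kernel_diag_commute: "K u v $ i $ i = K v u $ i $ i"
  using ip_commute[OF kernel_mem[of u "axis i 1"] kernel_mem[of v "axis i 1"]]
  by (simp only: ip_kernel_axis)

text \<open>The difference of kernel sections at \<open>u\<close> and \<open>v\<close> represents
  \<open>f u $ i - f v $ i\<close>, and its squared norm is exactly the kernel distance squared;
  Cauchy-Schwarz does the rest.\<close>

lemma component_diff_le:
  assumes f: "f \<in> H"
  shows "(f u $ i - f v $ i)\<^sup>2 \<le> ip f f * kernel_dist_sq (\<lambda>a b. K a b $ i $ i) u v"
proof -
  let ?k = "\<lambda>u y. K y u *v axis i 1"
  have k: "?k w \<in> H" for w
    by (rule kernel_mem)
  have "f u $ i - f v $ i = ip f (\<lambda>y. ?k u y - ?k v y)"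
    using reproducing[OF f, of "axis i 1"]
    by (simp add: ip_diff_right[OF k k f] inner_axis')
  moreover have "ip (\<lambda>y. ?k u y - ?k v y) (\<lambda>y. ?k u y - ?k v y)
      = kernel_dist_sq (\<lambda>a b. K a b $ i $ i) u v"
    using kernel_diag_commute[of u v i]
    by (simp add: ip_diff_left ip_diff_right k diff_mem ip_kernel_axis kernel_dist_sq_def)
  ultimately show ?thesis
    using Cauchy_Schwarz_ip[OF f diff_mem[OF k k], of u v] by simp
qed

text \<open>The componentwise bounds are summed through the l1 norm, hence the factor
  \<open>CARD('d)\<close>. The absolute value appears because the assumption sees \<open>N\<close>
  only through its square.\<close>

lemma lipschitz_if_kernel_dist_le:
  assumes f: "f \<in> H"
    and K: "\<And>u v i. kernel_dist_sq (\<lambda>a b. K a b $ i $ i) u v \<le> N\<^sup>2 * (norm (u - v))\<^sup>2"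
  shows "(CARD('d) * (ip_norm ip f * \<bar>N\<bar>))-lipschitz_on UNIV f"
proof (rule lipschitz_onI)
  have nn: "ip_norm ip f \<ge> 0"
    using ip_nonneg[OF f] by (simp add: ip_norm_def)
  then show "0 \<le> CARD('d) * (ip_norm ip f * \<bar>N\<bar>)"
    by simp
  fix u v
  have "\<bar>(f u - f v) $ i\<bar> \<le> ip_norm ip f * \<bar>N\<bar> * norm (u - v)" for i
  proof (rule power2_le_imp_le)
    have "(f u $ i - f v $ i)\<^sup>2 \<le> ip f f * kernel_dist_sq (\<lambda>a b. K a b $ i $ i) u v"
      by (rule component_diff_le[OF f])
    also have "\<dots> \<le> ip f f * (N\<^sup>2 * (norm (u - v))\<^sup>2)"
      by (rule mult_left_mono[OF K ip_nonneg[OF f]])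
    also have "\<dots> = (ip_norm ip f * \<bar>N\<bar> * norm (u - v))\<^sup>2"
      using ip_nonneg[OF f] by (simp add: ip_norm_def power_mult_distrib)
    finally show "\<bar>(f u - f v) $ i\<bar>\<^sup>2 \<le> (ip_norm ip f * \<bar>N\<bar> * norm (u - v))\<^sup>2"
      by simp
  qed (use nn in simp)
  then have "(\<Sum>i\<in>UNIV. \<bar>(f u - f v) $ i\<bar>) \<le> (\<Sum>i\<in>(UNIV::'d set). ip_norm ip f * \<bar>N\<bar> * norm (u - v))"
    by (intro sum_mono)
  then show "dist (f u) (f v) \<le> CARD('d) * (ip_norm ip f * \<bar>N\<bar>) * dist u v"
    using norm_le_l1_cart[of "f u - f v"] by (simp add: dist_norm)
qed

end

subsection \<open>The initial value problem for a globally Lipschitz right-hand side\<close>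

lemma integral_has_vector_derivative_atLeast:
  fixes h :: "real \<Rightarrow> 'a::banach"
  assumes h: "continuous_on {a..} h" and t: "t \<ge> a"
  shows "((\<lambda>u. integral {a..u} h) has_vector_derivative h t) (at t within {a..})"
proof -
  have "((\<lambda>u. integral {a..u} h) has_vector_derivative h t) (at t within {a..t+1})"
    using t by (intro integral_has_vector_derivative continuous_on_subset[OF h]) auto
  \<comment> \<open>Both sets agree on the neighbourhood \<open>{..<t+1}\<close> of
    \<open>t\<close>.\<close>
  moreover have "at t within {a..t+1} = at t within {a..}"
    by (rule at_within_nhd[of _ "{..<t+1}"]) auto
  ultimately show ?thesis
    by simp
qed

text \<open>In the norm weighted by \<open>exp (- c * t)\<close>, integration from 0 gains a factor
  \<open>1 / c\<close>. This gives both the boundedness of the Picard operator and its contraction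
  factor.\<close>

lemma norm_integral_exp_le:
  fixes h :: "real \<Rightarrow> 'a::banach"
  assumes c: "c > 0" and t: "t \<ge> 0" and A: "A \<ge> 0"
    and h: "continuous_on {0..} h"
    and le: "\<And>s. s \<ge> 0 \<Longrightarrow> norm (h s) \<le> A * exp (c * s)"
  shows "norm (exp (- c * t) *\<^sub>R integral {0..t} h) \<le> A / c"
proof -
  have I: "((\<lambda>s. A * exp (c * s)) has_integral (A / c * exp (c * t) - A / c * exp (c * 0))) {0..t}"
    using t c by (intro fundamental_theorem_of_calculus)
      (auto intro!: derivative_eq_intros simp flip: has_real_derivative_iff_has_vector_derivative)
  have "norm (integral {0..t} h) \<le> integral {0..t} (\<lambda>s. A * exp (c * s))"
  proof (rule integral_norm_bound_integral)
    show "h integrable_on {0..t}"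
      by (intro integrable_continuous_real continuous_on_subset[OF h]) auto
  qed (use I le in auto)
  also have "\<dots> = A / c * exp (c * t) - A / c"
    using integral_unique[OF I] by simp
  also have "\<dots> \<le> A / c * exp (c * t)"
    using A c by simp
  finally have "exp (- c * t) * norm (integral {0..t} h) \<le> exp (- c * t) * (A / c * exp (c * t))"
    by (intro mult_left_mono) auto
  also have "\<dots> = A / c"
    by (simp add: exp_minus)
  finally show ?thesis
    by simp
qed

lemma lipschitz_ivp_exists:
  fixes f :: "'a::banach \<Rightarrow> 'a"
  assumes f: "L-lipschitz_on UNIV f"
  shows "\<exists>x. solves_ivp f x0 x"
proof -
  have L: "L \<ge> 0"
    using f by (rule lipschitz_on_nonneg)
  have fL: "norm (f u - f v) \<le> L * norm (u - v)" for u v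
    using lipschitz_onD[OF f] by (simp add: dist_norm)
  define c where "c = L + 1"
  have c: "c > 0" "L / c < 1" "L / c \<ge> 0"
    using L by (auto simp: c_def)
  \<comment> \<open>\<open>h y\<close> is the right-hand side along
    \<open>x(s) = exp (c * s) y(s)\<close>; \<open>G\<close> is the Picard operator rewritten for
    \<open>y\<close>.\<close>
  define h where "h y s = f (exp (c * s) *\<^sub>R apply_bcontfun y s)" for y s
  define G where "G y t = exp (- c * t) *\<^sub>R (x0 + integral {0..t} (h y))" for y t
  have hc: "continuous_on S (h y)" for S y
    unfolding h_def
    by (intro continuous_on_compose2[OF lipschitz_on_continuous_on[OF f]] continuous_intros) auto
  have D: "((\<lambda>u. integral {0..u} (h y)) has_vector_derivative h y t) (at t within {0..})"
    if "t \<ge> 0" for y t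
    using integral_has_vector_derivative_atLeast[OF hc that] .
  have Gc: "continuous_on {0..} (G y)" for y
  proof -
    have "continuous_on {0..} (\<lambda>u. integral {0..u} (h y))"
      unfolding continuous_on_eq_continuous_within
      using D has_vector_derivative_continuous by fastforce
    then show ?thesis
      unfolding G_def by (intro continuous_intros)
  qed
  \<comment> \<open>Bounded continuous functions here live on the whole real line, so the image is
    frozen at its value at 0 for negative times.\<close>
  have "(\<lambda>t. G y (max 0 t)) \<in> bcontfun" for y
  proof (rule bcontfun_normI)
    show "continuous_on UNIV (\<lambda>t. G y (max 0 t))"
      by (intro continuous_on_compose2[OF Gc] continuous_intros) auto
    fix t :: real
    let ?A = "norm (f 0) + L * norm y"
    have "norm (h y s) \<le> ?A * exp (c * s)" if "s \<ge> 0" for s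
    proof -
      have "norm (h y s) \<le> norm (f 0) + norm (h y s - f 0)"
        by norm
      also have "\<dots> \<le> norm (f 0) + L * (exp (c * s) * norm (apply_bcontfun y s))"
        using fL[of "exp (c * s) *\<^sub>R apply_bcontfun y s" 0] by (simp add: h_def)
      \<comment> \<open>The constant term is absorbed since \<open>exp (c * s)\<close> is at least 1
        for \<open>s \<ge> 0\<close>.\<close>
      also have "\<dots> \<le> norm (f 0) * exp (c * s) + L * (exp (c * s) * norm y)"
        using that c(1) L by (intro add_mono mult_left_mono norm_bounded) (auto simp: mult_le_cancel_left1)
      finally show ?thesis
        by (simp add: algebra_simps)
    qed
    then have "norm (exp (- c * max 0 t) *\<^sub>R integral {0..max 0 t} (h y)) \<le> ?A / c"
      using c L hc by (intro norm_integral_exp_le) auto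
    moreover have "norm (exp (- c * max 0 t) *\<^sub>R x0) \<le> norm x0"
      using c(1) by (simp add: mult_left_le_one_le)
    ultimately show "norm (G y (max 0 t)) \<le> norm x0 + ?A / c"
      unfolding G_def scaleR_add_right by (intro norm_triangle_mono)
  qed
  then have T: "apply_bcontfun (Bcontfun (\<lambda>t. G y (max 0 t))) t = G y (max 0 t)" for y t
    by (simp add: Bcontfun_inverse)
  have "\<exists>!y. Bcontfun (\<lambda>t. G y (max 0 t)) = y"
  proof (rule banach_fix_type[OF c(3,2)], intro allI)
    fix y z
    show "dist (Bcontfun (\<lambda>t. G y (max 0 t))) (Bcontfun (\<lambda>t. G z (max 0 t))) \<le> L / c * dist y z"
    proof (rule dist_bound)
      fix t :: real
      let ?t = "max 0 t"
      have "norm (h y s - h z s) \<le> (L * dist y z) * exp (c * s)" for s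
      proof -
        have "norm (h y s - h z s) \<le> L * (exp (c * s) * dist (apply_bcontfun y s) (apply_bcontfun z s))"
          unfolding h_def
          by (rule order_trans[OF fL]) (simp add: dist_norm flip: scaleR_diff_right)
        also have "\<dots> \<le> L * (exp (c * s) * dist y z)"
          using L by (intro mult_left_mono dist_bounded) auto
        finally show ?thesis
          by (simp add: algebra_simps)
      qed
      then have "norm (exp (- c * ?t) *\<^sub>R integral {0..?t} (\<lambda>s. h y s - h z s)) \<le> L * dist y z / c"
        using c L hc by (intro norm_integral_exp_le continuous_intros) auto
      \<comment> \<open>The initial value \<open>x0\<close> cancels.\<close>
      moreover have "G y ?t - G z ?t = exp (- c * ?t) *\<^sub>R integral {0..?t} (\<lambda>s. h y s - h z s)"
        unfolding G_def
        by (subst integral_diff) (auto intro!: integrable_continuous_real hc simp: algebra_simps)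
      ultimately show "dist (apply_bcontfun (Bcontfun (\<lambda>t. G y (max 0 t))) t)
          (apply_bcontfun (Bcontfun (\<lambda>t. G z (max 0 t))) t) \<le> L / c * dist y z"
        by (simp add: T dist_norm)
    qed
  qed
  then obtain y where y: "Bcontfun (\<lambda>t. G y (max 0 t)) = y"
    by blast
  have yG: "apply_bcontfun y t = G y t" if "t \<ge> 0" for t
    using T[of y t] that by (simp add: y)
  \<comment> \<open>Undoing the weight: by the fixed point equation, \<open>x t\<close> equals
    \<open>exp (c * t)\<close> times \<open>y\<close> at \<open>t\<close> for
    \<open>t \<ge> 0\<close>.\<close>
  define x where "x t = x0 + integral {0..t} (h y)" for t
  have "h y t = f (x t)" if "t \<ge> 0" for t
    using that by (simp add: h_def yG G_def x_def exp_minus)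
  then have "(x has_vector_derivative f (x t)) (at t within {0..})" if "t \<ge> 0" for t
    using D[OF that, of y] that unfolding x_def by (auto intro!: derivative_eq_intros)
  then show ?thesis
    unfolding solves_ivp_def by (intro exI[of _ x]) (auto simp: x_def)
qed

lemma lipschitz_ivp_unique:
  fixes f :: "'a::real_inner \<Rightarrow> 'a"
  assumes f: "L-lipschitz_on UNIV f"
    and x: "solves_ivp f x0 x" and y: "solves_ivp f x0 y" and t: "t \<ge> 0"
  shows "x t = y t"
proof -
  define d where "d s = x s - y s" for s
  define p where "p s = exp (- 2 * L * s) * (d s \<bullet> d s)" for s
  have dD: "(d has_vector_derivative f (x s) - f (y s)) (at s within {0..t})" if "s \<in> {0..t}" for s
    unfolding d_def using x y that
    by (auto simp: solves_ivp_def intro!: has_vector_derivative_diff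
        intro: has_vector_derivative_within_subset[of _ _ _ "{0..}"])
  \<comment> \<open>The derivative of \<open>p\<close>. The rate \<open>2 * L\<close> in the weight
    makes it nonpositive, by Cauchy-Schwarz and the Lipschitz bound.\<close>
  define p' where "p' s = 2 * exp (- 2 * L * s) * (d s \<bullet> (f (x s) - f (y s)) - L * (d s \<bullet> d s))" for s
  have pD: "(p has_real_derivative p' s) (at s within {0..t})" if "s \<in> {0..t}" for s
  proof -
    have "((\<lambda>s. d s \<bullet> d s) has_real_derivative 2 * (d s \<bullet> (f (x s) - f (y s)))) (at s within {0..t})"
      using has_derivative_inner[OF dD[OF that, unfolded has_vector_derivative_def]
          dD[OF that, unfolded has_vector_derivative_def]]
      unfolding has_field_derivative_def
      by (rule has_derivative_eq_rhs) (auto simp: inner_commute)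
    then show ?thesis
      unfolding p_def p'_def
      by (auto intro!: derivative_eq_intros simp: algebra_simps)
  qed
  have "p' s \<le> 0" for s
  proof -
    have "d s \<bullet> (f (x s) - f (y s)) \<le> norm (d s) * norm (f (x s) - f (y s))"
      by (rule norm_cauchy_schwarz)
    also have "\<dots> \<le> norm (d s) * (L * norm (d s))"
      using lipschitz_onD[OF f, of "x s" "y s"]
      by (intro mult_left_mono) (auto simp: dist_norm d_def)
    also have "\<dots> = L * (d s \<bullet> d s)"
      by (simp add: dot_square_norm power2_eq_square)
    finally show ?thesis
      unfolding p'_def by (intro mult_nonneg_nonpos) auto
  qed
  moreover obtain s where "p t - p 0 = p' s * (t - 0)"
    using mvt_very_simple[OF t pD[unfolded has_field_derivative_def]] by auto
  ultimately have "p t \<le> p 0"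
    using t mult_nonpos_nonneg[of "p' s" t] by simp
  also have "p 0 = 0"
    using x y by (simp add: p_def d_def solves_ivp_def)
  finally have "d t \<bullet> d t \<le> 0"
    by (simp add: p_def mult_le_0_iff)
  then have "d t = 0"
    using inner_gt_zero_iff[of "d t"] by linarith
  then show ?thesis
    by (simp add: d_def)
qed

theorem lemma1:
  fixes f :: "real ^ 'd::finite \<Rightarrow> real ^ 'd"
    and H :: "(real ^ 'd \<Rightarrow> real ^ 'd) set"
    and ip :: "(real ^ 'd \<Rightarrow> real ^ 'd) \<Rightarrow> (real ^ 'd \<Rightarrow> real ^ 'd) \<Rightarrow> real"
    and K :: "real ^ 'd \<Rightarrow> real ^ 'd \<Rightarrow> real ^ 'd ^ 'd"
    and N\<^sub>K :: real
    and x0 :: "real ^ 'd"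
  assumes "vector_rkhs H ip K"
    and "f \<in> H"
    and "\<And>u v i. kernel_dist_sq (\<lambda>a b. K a b $ i $ i) u v \<le> N\<^sub>K\<^sup>2 * (norm (u - v))\<^sup>2"
  shows "\<exists>!x. x \<in> extensional {0..} \<and> solves_ivp f x0 x"
proof -
  interpret vector_rkhs H ip K
    by (rule assms(1))
  note f = lipschitz_if_kernel_dist_le[OF assms(2,3)]
  obtain x where x: "solves_ivp f x0 x"
    using lipschitz_ivp_exists[OF f] by blast
  \<comment> \<open>Values at negative times are left free by \<open>solves_ivp\<close>; restriction
    fixes them to \<open>undefined\<close>, so that the solution is unique as a function. The
    derivative within \<open>{0..}\<close> does not see this change.\<close>
  have "(restrict x {0..} has_vector_derivative f (x t)) (at t within {0..})" if "t \<ge> 0" for t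
    by (rule has_vector_derivative_transform[where f = x]) (use x that in \<open>auto simp: solves_ivp_def\<close>)
  then have "solves_ivp f x0 (restrict x {0..})"
    using x by (simp add: solves_ivp_def)
  moreover have "z = restrict x {0..}" if "z \<in> extensional {0..}" "solves_ivp f x0 z" for z
    using lipschitz_ivp_unique[OF f that(2) x] that(1) by (intro extensionalityI) auto
  ultimately show ?thesis
    by (intro ex1I[of _ "restrict x {0..}"]) auto
qed

end
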